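(* Let $m\ge 2$ and $n\ge 1$ be integers and let $\mathcal{Q}=(\mathcal{A},\mathcal{B},-\mathcal{I})\in\mathcal{F}_{m,n}$, where $\mathcal{I}$ is the unit tensor. Assume that $\mathcal{A}$ and $\mathcal{B}$ are both symmetric. Let $(\bar u,\bar v)\in\mathbb{R}^n\times\mathbb{R}^n$ with $\bar u\ne 0$ be a stationary point of the problem $$\max\ \varphi_0(u,v):=m(m-1)^{\frac1m-1}v^\top u^{[m-1]}-\mathcal{B}u^m\quad\text{s.t.}\quad \mathcal{A}u^m+v^\top v^{[m-1]}=1,\ u\ge 0,\ v\ge 0.$$ Then $(\bar\lambda,\bar u)$ is an $m$-degree Pareto-eigenpair of $\mathcal{Q}$, where $\bar\lambda=(\varphi_0(\bar u,\bar v))^{\frac{1}{m-1}}$.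
   Context: $\mathcal{T}_{m,n}$ is the space of real $m$-th order $n$-dimensional tensors $\mathcal{A}=(a_{i_1\ldots i_m})$, and $\mathcal{F}_{m,n}=\mathcal{T}_{m,n}\times\mathcal{T}_{m,n}\times\mathcal{T}_{m,n}$. A tensor is symmetric if its entries are invariant under any permutation of the indices. The unit tensor $\mathcal{I}\in\mathcal{T}_{m,n}$ has entries $1$ when $i_1=\cdots=i_m$ and $0$ otherwise. For $x\in\mathbb{R}^n$, $\mathcal{A}x^{m-1}\in\mathbb{R}^n$ has $i$-th component $\sum_{i_2,\ldots,i_m=1}^n a_{ii_2\ldots i_m}x_{i_2}\cdots x_{i_m}$, and $\mathcal{A}x^m=\langle x,\mathcal{A}x^{m-1}\rangle$. For an integer $r\ge 0$, $x^{[r]}=(x_1^r,\ldots,x_n^r)^\top$ (so $x^{[0]}=(1,\ldots,1)^\top$); $\mathrm{diag}(x)$ is the diagonal matrix with diagonal $x$. $(\lambda,x)\in\mathbb{R}\times(\mathbb{R}^n\setminus\{0\})$ is an $m$-degree Pareto-eigenpair of $(\mathcal{A},\mathcal{B},\mathcal{C})$ if $x\ge 0$, $(\lambda^m\mathcal{A}+\lambda\mathcal{B}+\mathcal{C})x^{m-1}\ge 0$ (componentwise) and $\langle x,(\lambda^m\mathcal{A}+\lambda\mathcal{B}+\mathcal{C})x^{m-1}\rangle=0$. A stationary point of the optimization problem means a KKT point: $(\bar u,\bar v)$ such that there exist $\bar\alpha,\bar\beta\in\mathbb{R}^n$ and $\bar\gamma\in\mathbb{R}$ with $m\mathcal{B}\bar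 u^{m-1}-m(m-1)^{\frac1m}\mathrm{diag}(\bar v)\bar u^{[m-2]}=\bar\alpha+\bar\gamma m\mathcal{A}\bar u^{m-1}$; $-m(m-1)^{\frac1m-1}\bar u^{[m-1]}=\bar\beta+\bar\gamma m\bar v^{[m-1]}$; $\bar\alpha\ge0,\ \bar u\ge0,\ \bar\alpha^\top\bar u=0$; $\bar\beta\ge0,\ \bar v\ge0,\ \bar\beta^\top\bar v=0$; $\mathcal{A}\bar u^m+\bar v^\top\bar v^{[m-1]}=1$. *)

theory Defs
  imports "HOL-Analysis.Analysis" "HOL-Combinatorics.Permutations"
begin

text \<open>The entry with indices \<open>i\<^sub>1, \<dots>, i\<^sub>m\<close> of an \<open>m\<close>-th order tensor \<open>A\<close> of
  dimension \<open>n = CARD('n)\<close> is \<open>A [i\<^sub>1, \<dots>, i\<^sub>m]\<close>. The order \<open>m\<close> is a parameter of the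
  notions below, which only use the values of \<open>A\<close> at lists of length \<open>m\<close> (for \<open>m \<ge> 1\<close>).\<close>

type_synonym 'n tensor = "'n list \<Rightarrow> real"

definition symmetric_tensor :: "nat \<Rightarrow> 'n::finite tensor \<Rightarrow> bool" where
  "symmetric_tensor m A \<longleftrightarrow>
     (\<forall>js p. length js = m \<longrightarrow> p permutes {..<m} \<longrightarrow> A (permute_list p js) = A js)"

definition unit_tensor :: "'n::finite tensor" where
  "unit_tensor js = (if \<forall>i\<in>set js. \<forall>j\<in>set js. i = j then 1 else 0)"

text \<open>\<open>A x\<^sup>m\<^sup>-\<^sup>1\<close> and \<open>A x\<^sup>m\<close>: the list \<open>js\<close> stands for the indices \<open>i\<^sub>2, \<dots>, i\<^sub>m\<close>.\<close>

definition tensor_apply :: "nat \<Rightarrow> 'n::finite tensor \<Rightarrow> real ^ 'n \<Rightarrow> real ^ 'n" where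
  "tensor_apply m A x =
     (\<chi> i. \<Sum>js\<in>{js. length js = m - 1}. A (i # js) * prod_list (map (\<lambda>j. x $ j) js))"

definition tensor_form :: "nat \<Rightarrow> 'n::finite tensor \<Rightarrow> real ^ 'n \<Rightarrow> real" where
  "tensor_form m A x = x \<bullet> tensor_apply m A x"

definition vec_power :: "real ^ 'n::finite \<Rightarrow> nat \<Rightarrow> real ^ 'n" where
  "vec_power x r = (\<chi> i. (x $ i) ^ r)"

definition diag_matrix :: "real ^ 'n::finite \<Rightarrow> real ^ 'n ^ 'n" where
  "diag_matrix x = (\<chi> i j. if i = j then x $ i else 0)"

definition tensor_pencil ::
  "nat \<Rightarrow> 'n::finite tensor \<times> 'n tensor \<times> 'n tensor \<Rightarrow> real \<Rightarrow> 'n tensor" where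
  "tensor_pencil m Q l = (case Q of (A, B, C) \<Rightarrow> (\<lambda>js. l ^ m * A js + l * B js + C js))"

text \<open>The order on \<open>real ^ 'n\<close> is the componentwise one.\<close>

definition pareto_eigenpair ::
  "nat \<Rightarrow> 'n::finite tensor \<times> 'n tensor \<times> 'n tensor \<Rightarrow> real \<Rightarrow> real ^ 'n \<Rightarrow> bool" where
  "pareto_eigenpair m Q l x \<longleftrightarrow>
     x \<noteq> 0 \<and> 0 \<le> x \<and> 0 \<le> tensor_apply m (tensor_pencil m Q l) x \<and>
     x \<bullet> tensor_apply m (tensor_pencil m Q l) x = 0"

definition phi0 :: "nat \<Rightarrow> 'n::finite tensor \<Rightarrow> real ^ 'n \<Rightarrow> real ^ 'n \<Rightarrow> real" where
  "phi0 m B u v =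
     real m * (real m - 1) powr (1 / real m - 1) * (v \<bullet> vec_power u (m - 1)) - tensor_form m B u"

text \<open>KKT points of the problem of maximising \<open>phi0 m B u v\<close> subject to
  \<open>tensor_form m A u + v \<bullet> vec_power v (m - 1) = 1\<close>, \<open>u \<ge> 0\<close> and \<open>v \<ge> 0\<close>. The first two
  equations equate the partial gradients of \<open>- phi0 m B\<close> (for symmetric \<open>B\<close>) with
  combinations of the constraint gradients (for symmetric \<open>A\<close>); for \<open>m = 2\<close>, the vector
  \<open>vec_power u (m - 2)\<close> is the all-ones vector, also where \<open>u\<close> vanishes.\<close>

definition stationary_point ::
  "nat \<Rightarrow> 'n::finite tensor \<Rightarrow> 'n tensor \<Rightarrow> real ^ 'n \<Rightarrow> real ^ 'n \<Rightarrow> bool" where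
  "stationary_point m A B u v \<longleftrightarrow>
     (\<exists>\<alpha> \<beta> :: real ^ 'n. \<exists>\<gamma> :: real.
        real m *\<^sub>R tensor_apply m B u
          - (real m * (real m - 1) powr (1 / real m)) *\<^sub>R (diag_matrix v *v vec_power u (m - 2))
          = \<alpha> + (\<gamma> * real m) *\<^sub>R tensor_apply m A u \<and>
        - ((real m * (real m - 1) powr (1 / real m - 1)) *\<^sub>R vec_power u (m - 1))
          = \<beta> + (\<gamma> * real m) *\<^sub>R vec_power v (m - 1) \<and>
        0 \<le> \<alpha> \<and> 0 \<le> u \<and> \<alpha> \<bullet> u = 0 \<and>
        0 \<le> \<beta> \<and> 0 \<le> v \<and> \<beta> \<bullet> v = 0 \<and>
        tensor_form m A u + v \<bullet> vec_power v (m - 1) = 1)"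

end

theory Submission imports Defs begin

text \<open>
  Write \<open>k = m - 1\<close> and \<open>c = k powr (1/m)\<close>, so that \<open>c ^ m = k\<close>. The eigenvalue is
  found from the multiplier \<open>\<gamma>\<close> of the equality constraint.

  Both \<open>phi0\<close> and the constraint function are homogeneous of degree \<open>m\<close>. Pairing the two gradient
  equations with \<open>u\<close> and \<open>v\<close> therefore gives Euler's identity in the form
  \<open>phi0 m B u v = - \<gamma>\<close> (\<open>phi0_eq_uminus_multiplier\<close>).

  The second gradient equation decouples into scalar equations in \<open>u\<^sub>i\<close> and \<open>v\<^sub>i\<close>. Since
  \<open>u \<noteq> 0\<close>, these force \<open>\<gamma> < 0\<close>, and complementarity then forces \<open>\<beta> = 0\<close>. Hence \<open>v\<close> is
  proportional to \<open>u\<close>, with a factor \<open>\<mu> > 0\<close> such that \<open>\<mu> ^ k = c / (k * (- \<gamma>))\<close>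
  (\<open>stationary_v_proportional_u\<close>).

  Put \<open>\<lambda> = root k (- \<gamma>)\<close>. Then \<open>(\<lambda> * c * \<mu>) ^ k = c ^ m / k = 1\<close>, so \<open>\<lambda> * c * \<mu> = 1\<close>; this is what
  the constant in the objective is chosen for. Substituting \<open>v = \<mu> u\<close> into the first gradient
  equation and multiplying by \<open>\<lambda> / m\<close> turns its left side into \<open>\<lambda> B u\<^sup>m\<^sup>-\<^sup>1 - u\<^sup>[\<^sup>m\<^sup>-\<^sup>1\<^sup>]\<close>. The pencil
  at \<open>\<lambda>\<close> therefore sends \<open>u\<close> to \<open>(\<lambda> / m) \<alpha>\<close>, and the Pareto conditions are those that the
  multiplier \<open>\<alpha>\<close> of \<open>u \<ge> 0\<close> satisfies.
\<close>

lemma tensor_apply_pencil: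
  "tensor_apply m (tensor_pencil m (A, B, C) l) x =
     l ^ m *\<^sub>R tensor_apply m A x + l *\<^sub>R tensor_apply m B x + tensor_apply m C x"
  by (simp add: vec_eq_iff tensor_apply_def tensor_pencil_def distrib_right sum.distrib
      sum_distrib_left mult.assoc)

lemma tensor_apply_uminus: "tensor_apply m (- C) x = - tensor_apply m C x"
  by (simp add: vec_eq_iff tensor_apply_def sum_negf)

text \<open>Only the constant list \<open>js = [i, \<dots>, i]\<close> contributes to the \<open>i\<close>-th component.\<close>

lemma tensor_apply_unit_tensor:
  fixes x :: "real ^ 'n::finite"
  shows "tensor_apply m unit_tensor x = vec_power x (m - 1)"
proof -
  have "(\<Sum>js\<in>{js. length js = m - 1}. unit_tensor (i # js) * prod_list (map (\<lambda>j. x $ j) js)) =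
        x $ i ^ (m - 1)" for i :: 'n
  proof -
    have "finite {js :: 'n list. length js = m - 1}"
      using finite_lists_length_eq[of "UNIV :: 'n set" "m - 1"] by simp
    moreover have "unit_tensor (i # js) = (0 :: real)"
      if "js \<in> {js. length js = m - 1} - {replicate (m - 1) i}" for js
    proof -
      have "\<exists>j\<in>set js. j \<noteq> i"
        using that replicate_eqI[of js "m - 1" i] by auto
      then show ?thesis by (auto simp: unit_tensor_def)
    qed
    moreover have "unit_tensor (i # replicate (m - 1) i) = (1 :: real)"
      by (auto simp: unit_tensor_def)
    ultimately show ?thesis
      by (subst sum.mono_neutral_right[where S = "{replicate (m - 1) i}"])
         (auto simp: map_replicate prod_list_replicate)
  qed
  then show ?thesis by (simp add: tensor_apply_def vec_power_def)
qed

lemma diag_matrix_mult_vec: "(diag_matrix v *v w) $ i = v $ i * w $ i"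
  by (simp add: matrix_vector_mult_def diag_matrix_def if_distrib[of "\<lambda>t. t * _"]
      cong: if_cong)

lemma inner_diag_vec_power:
  assumes "m \<ge> 2"
  shows "u \<bullet> (diag_matrix v *v vec_power u (m - 2)) = v \<bullet> vec_power u (m - 1)"
proof -
  have "m - 1 = Suc (m - 2)" using assms by simp
  then show ?thesis
    by (simp add: inner_vec_def diag_matrix_mult_vec vec_power_def algebra_simps)
qed

text \<open>Euler's identity at a stationary point. In \<open>phi0\<close> the coefficient of
  \<open>v \<bullet> vec_power u (m - 1)\<close> is \<open>m d\<close> with \<open>d = (m - 1) powr (1/m - 1)\<close>. It splits as
  \<open>(m - 1) d + d\<close>, where the first summand comes from pairing the \<open>u\<close>-gradient with \<open>u\<close> and the
  second from pairing the \<open>v\<close>-gradient with \<open>v\<close>.\<close>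

lemma phi0_eq_uminus_multiplier:
  assumes m: "m \<ge> 2"
    and grad_u: "real m *\<^sub>R tensor_apply m B u
          - (real m * (real m - 1) powr (1 / real m)) *\<^sub>R (diag_matrix v *v vec_power u (m - 2))
          = \<alpha> + (\<gamma> * real m) *\<^sub>R tensor_apply m A u"
    and grad_v: "- ((real m * (real m - 1) powr (1 / real m - 1)) *\<^sub>R vec_power u (m - 1))
          = \<beta> + (\<gamma> * real m) *\<^sub>R vec_power v (m - 1)"
    and "\<alpha> \<bullet> u = 0" and "\<beta> \<bullet> v = 0"
    and constr: "tensor_form m A u + v \<bullet> vec_power v (m - 1) = 1"
  shows "phi0 m B u v = - \<gamma>"
proof -
  define d where "d = (real m - 1) powr (1 / real m - 1)"
  define s where "s = v \<bullet> vec_power u (m - 1)"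
  have c: "(real m - 1) powr (1 / real m) = (real m - 1) * d"
    using m by (simp add: d_def powr_diff)
  have "u \<bullet> (real m *\<^sub>R tensor_apply m B u
          - (real m * (real m - 1) powr (1 / real m)) *\<^sub>R (diag_matrix v *v vec_power u (m - 2)))
        = u \<bullet> (\<alpha> + (\<gamma> * real m) *\<^sub>R tensor_apply m A u)"
    by (simp only: grad_u)
  then have "real m * (tensor_form m B u - (real m - 1) * d * s) = real m * (\<gamma> * tensor_form m A u)"
    using \<open>\<alpha> \<bullet> u = 0\<close>
    by (simp add: inner_diff_right inner_add_right inner_diag_vec_power[OF m] tensor_form_def c
        s_def inner_commute[of u \<alpha>] algebra_simps)
  then have u: "tensor_form m B u - (real m - 1) * d * s = \<gamma> * tensor_form m A u"
    using m by simp
  have "v \<bullet> - ((real m * d) *\<^sub>R vec_power u (m - 1))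
        = v \<bullet> (\<beta> + (\<gamma> * real m) *\<^sub>R vec_power v (m - 1))"
    by (simp only: grad_v d_def)
  then have "real m * (- d * s) = real m * (\<gamma> * (v \<bullet> vec_power v (m - 1)))"
    using \<open>\<beta> \<bullet> v = 0\<close>
    by (simp add: inner_add_right s_def inner_commute[of v \<beta>] algebra_simps)
  then have v: "- d * s = \<gamma> * (v \<bullet> vec_power v (m - 1))"
    using m by (simp only: mult_cancel_left) simp
  have "phi0 m B u v = real m * d * s - tensor_form m B u"
    by (simp add: phi0_def d_def s_def)
  also have "\<dots> = - (\<gamma> * (tensor_form m A u + v \<bullet> vec_power v (m - 1)))"
    using u v by (simp add: algebra_simps)
  finally show ?thesis by (simp only: constr mult_1_right)
qed

text \<open>The equation can be solved one component at a time. Where \<open>u\<^sub>i > 0\<close>, its left side is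
  negative and \<open>\<beta>\<^sub>i \<ge> 0\<close>, so \<open>\<gamma> * M * v\<^sub>i ^ k < 0\<close>; one such component fixes the sign of \<open>\<gamma>\<close>.
  If \<open>\<beta>\<^sub>i > 0\<close> for some \<open>i\<close>, then \<open>v\<^sub>i = 0\<close> by complementarity, and the equation would equate a
  number \<open>\<le> 0\<close> with \<open>\<beta>\<^sub>i\<close>. So \<open>\<beta> = 0\<close>, and \<open>v\<^sub>i\<close> is found by taking \<open>k\<close>-th roots.\<close>

lemma stationary_v_proportional_u:
  fixes u v \<beta> :: "real ^ 'n::finite"
  assumes k: "k > 0" and a: "a > 0" and M: "M > 0" and "u \<noteq> 0"
    and grad_v: "- (a *\<^sub>R vec_power u k) = \<beta> + (\<gamma> * M) *\<^sub>R vec_power v k"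
    and u: "0 \<le> u" and v: "0 \<le> v" and \<beta>: "0 \<le> \<beta>" and compl: "\<beta> \<bullet> v = 0"
  shows "\<gamma> < 0" and "v = root k (a / (M * - \<gamma>)) *\<^sub>R u"
proof -
  have nonneg: "0 \<le> u $ i" "0 \<le> v $ i" "0 \<le> \<beta> $ i" for i
    using u v \<beta> by (simp_all add: less_eq_vec_def)
  have eq: "- (a * u $ i ^ k) = \<beta> $ i + \<gamma> * M * v $ i ^ k" for i
    using arg_cong[OF grad_v, of "\<lambda>w. w $ i"] by (simp add: vec_power_def)
  have "(\<Sum>i\<in>UNIV. \<beta> $ i * v $ i) = 0"
    using compl by (simp add: inner_vec_def)
  then have compl': "\<beta> $ i = 0 \<or> v $ i = 0" for i
    using nonneg by (simp add: sum_nonneg_eq_0_iff)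
  obtain i where "u $ i \<noteq> 0" using \<open>u \<noteq> 0\<close> by (auto simp: vec_eq_iff)
  then have "0 < a * u $ i ^ k" using nonneg[of i] a by simp
  then have "\<gamma> * (M * v $ i ^ k) < 0" using eq[of i] nonneg(3)[of i] by simp
  moreover have "0 \<le> M * v $ i ^ k" using nonneg M by simp
  ultimately show \<gamma>: "\<gamma> < 0" by (metis linorder_not_le mult_nonneg_nonneg)
  have "v $ i = root k (a / (M * - \<gamma>)) * u $ i" for i
  proof -
    have "\<beta> $ i = 0"
    proof (rule ccontr)
      assume "\<beta> $ i \<noteq> 0"
      then have "v $ i = 0" "\<beta> $ i > 0" using compl'[of i] nonneg(3)[of i] by auto
      moreover have "0 \<le> a * u $ i ^ k" using nonneg a by simp
      ultimately show False using eq[of i] k by (simp add: zero_power)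
    qed
    then have "v $ i ^ k = a / (M * - \<gamma>) * u $ i ^ k"
      using eq[of i] M \<gamma> by (simp add: field_simps)
    then have "root k (v $ i ^ k) = root k (a / (M * - \<gamma>)) * root k (u $ i ^ k)"
      by (simp only: real_root_mult)
    then show ?thesis using k nonneg by (simp add: real_root_power_cancel)
  qed
  then show "v = root k (a / (M * - \<gamma>)) *\<^sub>R u" by (simp add: vec_eq_iff)
qed

theorem theorem3p1:
  fixes m :: nat and A B :: "'n::finite tensor" and u v :: "real ^ 'n"
  assumes "m \<ge> 2"
    and "symmetric_tensor m A" and "symmetric_tensor m B"
    and "u \<noteq> 0"
    and "stationary_point m A B u v"
  shows "pareto_eigenpair m (A, B, - unit_tensor) (root (m - 1) (phi0 m B u v)) u"
proof -
  obtain \<alpha> \<beta> :: "real ^ 'n" and \<gamma> :: real where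
    grad_u: "real m *\<^sub>R tensor_apply m B u
          - (real m * (real m - 1) powr (1 / real m)) *\<^sub>R (diag_matrix v *v vec_power u (m - 2))
          = \<alpha> + (\<gamma> * real m) *\<^sub>R tensor_apply m A u"
    and grad_v: "- ((real m * (real m - 1) powr (1 / real m - 1)) *\<^sub>R vec_power u (m - 1))
          = \<beta> + (\<gamma> * real m) *\<^sub>R vec_power v (m - 1)"
    and \<alpha>: "0 \<le> \<alpha>" "\<alpha> \<bullet> u = 0" and \<beta>: "0 \<le> \<beta>" "\<beta> \<bullet> v = 0"
    and u: "0 \<le> u" and v: "0 \<le> v"
    and constr: "tensor_form m A u + v \<bullet> vec_power v (m - 1) = 1"
    using assms(5) unfolding stationary_point_def by blast
  define k where "k = m - 1"
  have k: "k > 0" "m = Suc k" "real m - 1 = real k" using \<open>m \<ge> 2\<close> by (auto simp: k_def)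
  define c where "c = real k powr (1 / real m)"
  define \<mu> where "\<mu> = root k (c / (real k * - \<gamma>))"
  define l where "l = root k (- \<gamma>)"
  have phi0: "phi0 m B u v = - \<gamma>"
    using phi0_eq_uminus_multiplier[OF \<open>m \<ge> 2\<close> grad_u grad_v \<alpha>(2) \<beta>(2) constr] .
  have c_pos: "c > 0" using k by (simp add: c_def)
  have c_pow: "c ^ m = real k"
    using k by (simp add: c_def powr_realpow[symmetric] powr_powr)
  have d: "real k powr (1 / real m - 1) = c / real k"
    using k by (simp add: c_def powr_diff)
  have grad_v': "- ((real m * (c / real k)) *\<^sub>R vec_power u k) = \<beta> + (\<gamma> * real m) *\<^sub>R vec_power v k"
    using grad_v by (simp only: k(3) d k_def[symmetric])
  have pos: "real m * (c / real k) > 0" "real m > 0" using k c_pos by simp_all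
  note multiplier = stationary_v_proportional_u[OF k(1) pos \<open>u \<noteq> 0\<close> grad_v' u v \<beta>]
  have \<gamma>: "\<gamma> < 0" by (rule multiplier(1))
  have "real m * (c / real k) / (real m * - \<gamma>) = c / (real k * - \<gamma>)"
    using pos(2) by (simp only: mult_divide_mult_cancel_left divide_divide_eq_left)
  then have v_eq: "v = \<mu> *\<^sub>R u" using multiplier(2) by (simp only: \<mu>_def)
  have l_pos: "l > 0" using k \<gamma> by (simp add: l_def)
  have l_pow: "l ^ k = - \<gamma>" using k \<gamma> by (simp add: l_def)
  have \<mu>_nonneg: "\<mu> \<ge> 0"
    unfolding \<mu>_def using k \<gamma> c_pos
    by (intro real_root_ge_zero divide_nonneg_nonneg mult_nonneg_nonneg) auto
  have \<mu>_pow: "\<mu> ^ k = c / (real k * - \<gamma>)"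
    unfolding \<mu>_def using k \<gamma> c_pos
    by (intro real_root_pow_pos2 divide_nonneg_nonneg mult_nonneg_nonneg) auto
  \<comment> \<open>The factors \<open>- \<gamma>\<close> of \<open>l ^ k\<close> and \<open>\<mu> ^ k\<close> cancel, so the constant \<open>c\<close> alone decides.\<close>
  have "(l * c * \<mu>) ^ k = c ^ m / real k"
    using k(1,2) \<gamma> by (simp add: power_mult_distrib l_pow \<mu>_pow field_simps)
  then have scale: "l * c * \<mu> = 1"
    using k(1) c_pow l_pos c_pos \<mu>_nonneg power_eq_imp_eq_base[of "l * c * \<mu>" k 1] by simp
  have "diag_matrix v *v vec_power u (m - 2) = \<mu> *\<^sub>R vec_power u k"
  proof -
    have "k = Suc (m - 2)" using \<open>m \<ge> 2\<close> by (simp add: k_def)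
    then show ?thesis by (simp add: vec_eq_iff diag_matrix_mult_vec vec_power_def v_eq)
  qed
  then have grad_u': "real m *\<^sub>R tensor_apply m B u - (real m * c * \<mu>) *\<^sub>R vec_power u k
      = \<alpha> + (\<gamma> * real m) *\<^sub>R tensor_apply m A u"
    using grad_u by (simp add: k(3) c_def)
  have "tensor_apply m (tensor_pencil m (A, B, - unit_tensor) l) u
      = (l ^ m) *\<^sub>R tensor_apply m A u + l *\<^sub>R tensor_apply m B u - vec_power u k"
    by (simp add: tensor_apply_pencil tensor_apply_uminus tensor_apply_unit_tensor k_def)
  also have "\<dots> = (l / real m) *\<^sub>R \<alpha>"
  proof -
    have "(l ^ m * a + l * b - w) = l / real m * \<alpha>'"
      if eq: "real m * b - real m * c * \<mu> * w = \<alpha>' + \<gamma> * real m * a" for a b w \<alpha>' :: real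
    proof -
      have "l / real m * \<alpha>' = l / real m * (real m * b - real m * c * \<mu> * w - \<gamma> * real m * a)"
        using eq by simp
      also have "\<dots> = l * b - (l * c * \<mu>) * w + l * (- \<gamma>) * a"
        using pos(2) by (simp add: field_simps)
      also have "\<dots> = l * b - w + l ^ m * a"
        by (simp only: scale l_pow[symmetric] k(2)) simp
      finally show ?thesis by simp
    qed
    moreover have "real m * tensor_apply m B u $ i - real m * c * \<mu> * vec_power u k $ i
        = \<alpha> $ i + \<gamma> * real m * tensor_apply m A u $ i" for i
      using arg_cong[OF grad_u', of "\<lambda>w. w $ i"] by simp
    ultimately show ?thesis by (simp add: vec_eq_iff)
  qed
  finally have pencil:
    "tensor_apply m (tensor_pencil m (A, B, - unit_tensor) l) u = (l / real m) *\<^sub>R \<alpha>" .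
  have "0 \<le> (l / real m) *\<^sub>R \<alpha>"
    using \<alpha>(1) l_pos by (simp add: less_eq_vec_def)
  then have "pareto_eigenpair m (A, B, - unit_tensor) l u"
    using \<open>u \<noteq> 0\<close> u \<alpha>(2)
    by (simp add: pareto_eigenpair_def pencil inner_commute[of u \<alpha>])
  then show ?thesis by (simp only: phi0 l_def k_def)
qed

end
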